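(* Assume that for each integer $d \ge 0$ the sequence $\{M_k(d)\}_{k=1}^\infty$ is bounded. Then for each $d$ there exists a smallest positive integer $N_d$ such that $M_k(d)=L(d)$ for all $k\geq N_d$. Furthermore, for any constant $A$ with $0 < A < \frac{1}{\log 2}$, we have \[ N_{d} \geq \lfloor \log_{2}(d) \rfloor + A \log \log d \] for all sufficiently large $d$.
   Context: $p(n)$ denotes the number of partitions of $n$ (with $p(0)=1$). For integers $k \ge 1$ and $n \ge 1$, let $\Delta_k(n) := \min\{|p(n) - m^k| : m \in \mathbb{Z}\}$. For an integer $d \ge 0$, let $M_k(d) := \max\{n \in \mathbb{N} : \Delta_k(n) \le d\}$ (equal to $\infty$ if this maximum does not exist), and let $L(d) := \max\{n : p(n) \le d+1\}$. *)

theory Defs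
  imports Complex_Main "HOL-Library.Multiset" "HOL-Library.Extended_Nat"
begin

definition partitions :: "nat \<Rightarrow> nat multiset set" where
  "partitions n = {P. (\<forall>x\<in>#P. 0 < x) \<and> sum_mset P = n}"

definition num_partitions :: "nat \<Rightarrow> nat" where
  "num_partitions n = card (partitions n)"

text \<open>The infimum of a nonempty set of natural numbers is its minimum.\<close>

definition Delta :: "nat \<Rightarrow> nat \<Rightarrow> nat" where
  "Delta k n = (INF m::int. nat \<bar>int (num_partitions n) - m ^ k\<bar>)"

text \<open>
  For \<open>k \<ge> 1\<close> the set of \<open>n\<close> below always contains \<open>1\<close> (see \<open>Delta_one\<close>), so its
  maximum exists iff it is finite.
\<close>

definition M :: "nat \<Rightarrow> nat \<Rightarrow> enat" where
  "M k d = (let S = {n. 1 \<le> n \<and> Delta k n \<le> d} in if finite S then enat (Max S) else \<infinity>)"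

definition L :: "nat \<Rightarrow> nat" where
  "L d = Max {n. num_partitions n \<le> d + 1}"

lemma finite_partitions: "finite (partitions n)"
proof -
  have "partitions n \<subseteq> (\<Union>s\<in>{..n}. multisets_of_size {..n} s)"
  proof
    fix P assume P: "P \<in> partitions n"
    have le: "x \<le> n" if "x \<in># P" for x
      using P that by (auto simp: partitions_def dest: multi_member_split)
    have "size P \<le> sum_mset P" if "\<forall>x\<in>#P. 0 < x" for P :: "nat multiset"
      using that by (induction P) auto
    with P have "size P \<le> n" by (auto simp: partitions_def)
    with le show "P \<in> (\<Union>s\<in>{..n}. multisets_of_size {..n} s)"
      by (auto simp: multisets_of_size_def)
  qed
  moreover have "finite (\<Union>s\<in>{..n}. multisets_of_size {..n} s)"
    by (intro finite_UN_I finite_atMost finite_multisets_of_size)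
  ultimately show ?thesis by (rule finite_subset)
qed

lemma num_partitions_0: "num_partitions 0 = 1"
proof -
  have "partitions 0 = {{#}}"
    by (auto simp: partitions_def) (metis multiset_nonemptyE less_irrefl)
  thus ?thesis by (simp add: num_partitions_def)
qed

lemma num_partitions_1: "num_partitions 1 = 1"
proof -
  have "P = {#1#}" if P: "P \<in> partitions 1" for P
  proof (cases P)
    case empty
    with P show ?thesis by (simp add: partitions_def)
  next
    case (add x Q)
    with P have "0 < x" "x + sum_mset Q = 1" and Q0: "\<forall>y\<in>#Q. 0 < y"
      by (auto simp: partitions_def)
    hence x: "x = 1" and Q: "sum_mset Q = 0" by linarith+
    from Q Q0 have "Q = {#}" by (cases Q) auto
    with add x show ?thesis by simp
  qed
  hence "partitions 1 = {{#1#}}" by (auto simp: partitions_def)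
  thus ?thesis by (simp add: num_partitions_def)
qed

lemma num_partitions_ge: "n \<le> num_partitions n"
proof -
  define f where "f = (\<lambda>j. replicate_mset j 1 + {#n - j#})"
  have "inj_on f {..<n}"
  proof (rule inj_onI)
    fix i j assume "f i = f j"
    hence "size (f i) = size (f j)" by simp
    thus "i = j" by (simp add: f_def)
  qed
  moreover have "f ` {..<n} \<subseteq> partitions n"
    by (auto simp: f_def partitions_def split: if_splits)
  ultimately have "card {..<n} \<le> card (partitions n)"
    using finite_partitions by (intro card_inj_on_le)
  thus ?thesis by (simp add: num_partitions_def)
qed

lemma finite_num_partitions_le: "finite {n. num_partitions n \<le> d}"
  by (rule finite_subset[of _ "{..d}"]) (auto intro: order_trans[OF num_partitions_ge])

lemma Delta_attained: "\<exists>m::int. Delta k n = nat \<bar>int (num_partitions n) - m ^ k\<bar>"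
proof -
  have "Delta k n \<in> range (\<lambda>m::int. nat \<bar>int (num_partitions n) - m ^ k\<bar>)"
    unfolding Delta_def by (rule Inf_nat_def1) simp
  thus ?thesis by auto
qed

lemma Delta_le: "Delta k n \<le> nat \<bar>int (num_partitions n) - m ^ k\<bar>"
  unfolding Delta_def by (rule cINF_lower) auto

lemma Delta_one: "Delta k 1 = 0"
  using Delta_le[of k 1 1] num_partitions_1 by simp

text \<open>
  Every integer is a first power, so boundedness of \<open>M k d\<close> in \<open>k\<close> is only
  meaningful for \<open>k \<ge> 2\<close>.
\<close>

lemma M_1: "M 1 d = \<infinity>"
proof -
  have "Delta 1 n = 0" for n
    using Delta_le[of 1 n "int (num_partitions n)"] by simp
  hence "{n. 1 \<le> n \<and> Delta 1 n \<le> d} = {1..}" by auto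
  thus ?thesis by (simp add: M_def infinite_Ici)
qed

end

theory Submission
  imports Defs "HOL-Real_Asymp.Real_Asymp"
begin

text \<open>
  Once \<open>2 ^ k\<close> exceeds \<open>p(B) + d\<close>, where \<open>B\<close> bounds \<open>M\<^sub>k(d)\<close>, only the powers \<open>0\<close> and \<open>\<plusminus>1\<close> can be
  within \<open>d\<close> of a relevant \<open>p(n)\<close>, so \<open>M\<^sub>k(d) = L(d)\<close>.

  For the lower bound, let \<open>\<theta> = A log 2 < 1\<close>, let \<open>k\<close> be the largest integer below
  \<open>\<lfloor>log\<^sub>2 d\<rfloor> + A log log d\<close>, so that \<open>2 ^ k \<le> d (log d)\<^sup>\<theta>\<close>, and let \<open>n\<close> be least with
  \<open>p(n) > 2 ^ k > d\<close>. If \<open>p(n) - 2 ^ k \<le> d\<close>, then \<open>M\<^sub>k(d) \<ge> n > L(d)\<close>, hence \<open>N\<^sub>d > k\<close>. It thus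
  suffices that the gap \<open>q(n) = p(n) - p(n - 1)\<close> is at most about \<open>p(n) / (log p(n))\<^sup>\<theta>\<close>. Now \<open>q(n)\<close>
  counts the partitions of \<open>n\<close> without ones. Those with at least \<open>r\<close> distinct parts number at most
  \<open>p(n) / r\<close>, and those with at most \<open>r\<close> distinct parts at most \<open>(n + 1) ^ (2 r)\<close>, which for
  \<open>r = n\<^sup>\<alpha>\<close> with \<open>\<theta> / 2 < \<alpha> < 1 / 2\<close> is negligible against \<open>p(n) \<ge> 2 ^ (\<surd>n - 2)\<close>. Since a
  partition of \<open>n\<close> has at most \<open>\<surd>(2 n)\<close> distinct parts, the same count gives
  \<open>log p(n) \<le> 2 \<surd>(2 n) log (n + 1)\<close>, which is \<open>o(r\<^sup>1\<^sup>/\<^sup>\<theta>)\<close>.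
\<close>

section \<open>Gaps between consecutive partition numbers\<close>

text \<open>Adding a part 1 is a bijection onto the partitions of \<open>Suc n\<close> that contain
  a 1.\<close>

lemma num_partitions_Suc:
  "num_partitions (Suc n) = num_partitions n + card {P \<in> partitions (Suc n). 1 \<notin># P}"
proof -
  have "add_mset 1 ` partitions n = {P \<in> partitions (Suc n). 1 \<in># P}"
  proof (intro equalityI subsetI)
    fix P assume "P \<in> {P \<in> partitions (Suc n). 1 \<in># P}"
    moreover from this obtain Q where "P = add_mset 1 Q" by (blast dest: multi_member_split)
    ultimately show "P \<in> add_mset 1 ` partitions n" by (auto simp: partitions_def)
  qed (auto simp: partitions_def)
  moreover have "card (add_mset 1 ` partitions n) = num_partitions n"
    unfolding num_partitions_def by (intro card_image inj_onI) simp
  moreover have "num_partitions (Suc n) =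
      card {P \<in> partitions (Suc n). 1 \<in># P} + card {P \<in> partitions (Suc n). 1 \<notin># P}"
    unfolding num_partitions_def
    by (subst card_Un_disjoint[symmetric])
       (auto simp: finite_partitions intro: arg_cong[where f = card])
  ultimately show ?thesis by simp
qed

lemma mono_num_partitions: "mono num_partitions"
  by (rule mono_iff_le_Suc[THEN iffD2]) (simp add: num_partitions_Suc)

section \<open>Counting partitions by their number of distinct parts\<close>

lemma part_le: "P \<in> partitions n \<Longrightarrow> x \<in># P \<Longrightarrow> x \<le> n"
  by (auto simp: partitions_def dest: multi_member_split)

lemma size_partition_le: "P \<in> partitions n \<Longrightarrow> size P \<le> n"
proof -
  have "size P \<le> sum_mset P" if "\<forall>x\<in>#P. 0 < x" for P :: "nat multiset"
    using that by (induction P) auto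
  thus "P \<in> partitions n \<Longrightarrow> size P \<le> n" by (auto simp: partitions_def)
qed

text \<open>A partition is determined by its pairs (part, multiplicity), whose entries are all at
  most \<open>n\<close>.\<close>

lemma card_partitions_few_distinct:
  "card {P \<in> partitions n. card (set_mset P) \<le> r} \<le> (n + 1) ^ (2 * r)"
proof -
  define X where "X = {xs. set xs \<subseteq> {..n} \<times> {..n} \<and> length xs = r}"
  define f :: "(nat \<times> nat) list \<Rightarrow> nat multiset"
    where "f = (\<lambda>xs. \<Sum>(a, c)\<leftarrow>xs. replicate_mset c a)"
  have "{P \<in> partitions n. card (set_mset P) \<le> r} \<subseteq> f ` X"
  proof
    fix P assume "P \<in> {P \<in> partitions n. card (set_mset P) \<le> r}"
    hence P: "P \<in> partitions n" "card (set_mset P) \<le> r" by auto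
    obtain ys where ys: "set ys = set_mset P" "distinct ys"
      using finite_distinct_list[of "set_mset P"] by auto
    hence len: "length ys = card (set_mset P)" by (metis distinct_card)
    \<comment> \<open>The pairs \<open>(0, 0)\<close> contribute nothing and pad the list to length
      exactly \<open>r\<close>.\<close>
    define xs where "xs = map (\<lambda>a. (a, count P a)) ys @ replicate (r - length ys) (0, 0)"
    have "sum_list (replicate j ({#} :: nat multiset)) = {#}" for j by (induction j) auto
    hence "f xs = (\<Sum>a\<leftarrow>ys. replicate_mset (count P a) a)"
      by (simp add: f_def xs_def o_def)
    also have "\<dots> = (\<Sum>a\<in>set_mset P. replicate_mset (count P a) a)"
      using ys by (simp add: sum_list_distinct_conv_sum_set)
    also have "\<dots> = P"
      by (rule multiset_eqI) (auto simp: count_sum if_distrib sum.If_cases not_in_iff)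
    finally have "f xs = P" .
    moreover have "count P a \<le> n" for a
      using size_partition_le[OF P(1)] count_le_size[of P a] by linarith
    hence "xs \<in> X"
      using ys len P(2) part_le[OF P(1)] by (auto simp: X_def xs_def)
    ultimately show "P \<in> f ` X" by blast
  qed
  moreover have "finite X" "card X = (n + 1) ^ (2 * r)"
    unfolding X_def by (auto simp: finite_lists_length_eq card_lists_length_eq card_cartesian_product
        power_mult power2_eq_square)
  ultimately show ?thesis by (metis surj_card_le)
qed

text \<open>
  Breaking one part \<open>a\<close> of a partition without ones into \<open>a\<close> ones is reversible, because \<open>a\<close> is
  then the number of ones. A partition without ones and with at least \<open>r\<close> distinct parts thus
  yields \<open>r\<close> partitions of its own.
\<close>

lemma partitions_without_one_bound:
  "r * card {P \<in> partitions n. 1 \<notin># P} \<le> num_partitions n + r * (n + 1) ^ (2 * r)"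
proof -
  define U where "U = {P \<in> partitions n. 1 \<notin># P \<and> r \<le> card (set_mset P)}"
  define g :: "nat multiset \<times> nat \<Rightarrow> nat multiset"
    where "g = (\<lambda>(P, a). P - {#a#} + replicate_mset a 1)"
  have fin: "finite U" by (simp add: U_def finite_partitions)
  have "inj_on g (Sigma U set_mset)"
  proof (rule inj_onI, clarify)
    fix P a Q b
    assume *: "P \<in> U" "a \<in># P" "Q \<in> U" "b \<in># Q" and eq: "g (P, a) = g (Q, b)"
    have c: "count (g (P, a)) 1 = a" if "P \<in> U" for P a
      using that by (auto simp: g_def U_def not_in_iff)
    have "a = b" using c * eq by metis
    moreover from this eq have "P - {#a#} = Q - {#b#}" by (simp add: g_def)
    ultimately show "P = Q \<and> a = b" using * by (metis insert_DiffM)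
  qed
  moreover have "g ` Sigma U set_mset \<subseteq> partitions n"
  proof clarify
    fix P a assume "P \<in> U" "a \<in># P"
    moreover from \<open>a \<in># P\<close> obtain Q where "P = add_mset a Q" by (blast dest: multi_member_split)
    ultimately show "g (P, a) \<in> partitions n"
      by (auto simp: g_def U_def partitions_def)
  qed
  ultimately have "card (Sigma U set_mset) \<le> num_partitions n"
    unfolding num_partitions_def by (intro card_inj_on_le finite_partitions)
  moreover have "card U * r \<le> (\<Sum>P\<in>U. card (set_mset P))"
    using sum_mono[of U "\<lambda>_. r" "\<lambda>P. card (set_mset P)"] by (auto simp: U_def)
  ultimately have 1: "card U * r \<le> num_partitions n"
    using fin by (simp add: card_SigmaI)
  have "{P \<in> partitions n. 1 \<notin># P} \<subseteq> U \<union> {P \<in> partitions n. card (set_mset P) \<le> r}"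
    by (auto simp: U_def)
  hence "card {P \<in> partitions n. 1 \<notin># P} \<le> card (U \<union> {P \<in> partitions n. card (set_mset P) \<le> r})"
    by (intro card_mono) (auto simp: fin finite_partitions)
  also have "\<dots> \<le> card U + (n + 1) ^ (2 * r)"
    using card_Un_le card_partitions_few_distinct add_left_mono order_trans by metis
  finally have "r * card {P \<in> partitions n. 1 \<notin># P} \<le> r * (card U + (n + 1) ^ (2 * r))"
    by (rule mult_left_mono) simp
  with 1 show ?thesis by (simp add: algebra_simps)
qed

section \<open>Growth of the partition numbers\<close>

lemma card_set_partition_squared_le:
  assumes "P \<in> partitions n" shows "card (set_mset P) ^ 2 \<le> 2 * n"
proof -
  have "card A ^ 2 \<le> 2 * \<Sum>A" if "finite A" "\<forall>x\<in>A. 0 < x" for A :: "nat set"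
    using that
  proof (induction A rule: finite_linorder_max_induct)
    case (insert b A)
    \<comment> \<open>The new maximum \<open>b\<close> is at least \<open>card A + 1\<close>, so
      \<open>2 * b\<close> covers the increment \<open>2 * card A + 1\<close> of the square.\<close>
    have "A \<subseteq> {1..<b}" using insert by force
    hence "card A \<le> b - 1" using card_mono[of "{1..<b}" A] by simp
    hence "card A + 1 \<le> b" using insert.prems by auto
    moreover have "b \<notin> A" using insert by auto
    ultimately show ?case using insert by (auto simp: power2_eq_square algebra_simps)
  qed simp
  from this[of "set_mset P"] have "card (set_mset P) ^ 2 \<le> 2 * \<Sum>(set_mset P)"
    using assms by (auto simp: partitions_def)
  also have "\<Sum>(set_mset P) \<le> sum_mset P"
    by (induction P) (auto simp: sum.insert_if)
  finally show ?thesis using assms by (simp add: partitions_def)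
qed

lemma ln_num_partitions_le: "ln (num_partitions n) \<le> 2 * sqrt (2 * n) * ln (n + 1)"
proof -
  define t where "t = nat \<lfloor>sqrt (2 * n)\<rfloor>"
  have t: "real t \<le> sqrt (2 * n)" by (simp add: t_def)
  have "card (set_mset P) \<le> t" if "P \<in> partitions n" for P
  proof -
    have "real (card (set_mset P) ^ 2) \<le> real (2 * n)"
      using card_set_partition_squared_le[OF that] by (simp only: of_nat_le_iff)
    hence "real (card (set_mset P)) \<le> sqrt (2 * n)" by (intro real_le_rsqrt) simp
    thus ?thesis by (simp add: t_def le_nat_floor)
  qed
  hence "{P \<in> partitions n. card (set_mset P) \<le> t} = partitions n" by auto
  hence "num_partitions n \<le> (n + 1) ^ (2 * t)"
    using card_partitions_few_distinct[of n t] by (simp add: num_partitions_def)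
  hence "real (num_partitions n) \<le> real ((n + 1) ^ (2 * t))" by (simp only: of_nat_le_iff)
  moreover have "num_partitions n > 0"
    using monoD[OF mono_num_partitions, of 0 n] num_partitions_0 by simp
  ultimately have "ln (num_partitions n) \<le> ln (real (n + 1) ^ (2 * t))"
    by (subst ln_le_cancel_iff) auto
  also have "\<dots> = 2 * real t * ln (n + 1)" by (subst ln_realpow) auto
  also have "\<dots> \<le> 2 * sqrt (2 * n) * ln (n + 1)"
    using t by (intro mult_right_mono) auto
  finally show ?thesis by (simp add: add.commute)
qed

text \<open>Each subset of \<open>{2..m}\<close> has sum at most \<open>n\<close> and is completed
  to a partition of \<open>n\<close> by ones; deleting the ones recovers the subset.\<close>

lemma two_power_le_num_partitions:
  assumes "m ^ 2 \<le> n" shows "2 ^ (m - 1) \<le> num_partitions n"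
proof -
  define f where "f = (\<lambda>S. mset_set S + replicate_mset (n - \<Sum>S) (1::nat))"
  have le: "\<Sum>S \<le> n" if "S \<subseteq> {2..m}" for S
  proof -
    have "\<Sum>S \<le> (\<Sum>x\<in>{2..m}. m)"
      using that by (intro order_trans[OF sum_mono2 sum_mono]) auto
    also have "\<dots> \<le> m ^ 2" by (simp add: power2_eq_square)
    finally show ?thesis using assms by simp
  qed
  have "inj_on f (Pow {2..m})"
  proof (rule inj_onI)
    fix S T assume *: "S \<in> Pow {2..m}" "T \<in> Pow {2..m}" and eq: "f S = f T"
    have "S = set_mset (f S) - {1}" if "S \<in> Pow {2..m}" for S
      using that finite_subset[of S "{2..m}"] by (force simp: f_def)
    with * eq show "S = T" by metis
  qed
  moreover have "f ` Pow {2..m} \<subseteq> partitions n"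
  proof clarify
    fix S assume S: "S \<subseteq> {2..m}"
    have "finite S" using S finite_subset by blast
    moreover have "\<Sum>\<^sub># (mset_set S) = \<Sum>S" by (simp add: sum_unfold_sum_mset)
    ultimately show "f S \<in> partitions n"
      using S le[OF S] by (auto simp: f_def partitions_def)
  qed
  ultimately have "card (Pow {2..m}) \<le> num_partitions n"
    unfolding num_partitions_def by (intro card_inj_on_le finite_partitions)
  thus ?thesis by (simp add: card_Pow)
qed

section \<open>Comparing \<open>M\<close> with \<open>L\<close>\<close>

lemma Delta_le_iff: "Delta k n \<le> d \<longleftrightarrow> (\<exists>m::int. \<bar>int (num_partitions n) - m ^ k\<bar> \<le> int d)"
  by (metis Delta_attained Delta_le le_trans nat_le_iff)

lemma num_partitions_L_le: "num_partitions (L d) \<le> d + 1"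
proof -
  have "0 \<in> {n. num_partitions n \<le> d + 1}" using num_partitions_0 by simp
  hence "L d \<in> {n. num_partitions n \<le> d + 1}"
    unfolding L_def by (intro Max_in finite_num_partitions_le) blast
  thus ?thesis by simp
qed

lemma le_L_iff: "n \<le> L d \<longleftrightarrow> num_partitions n \<le> d + 1"
proof
  assume "n \<le> L d"
  thus "num_partitions n \<le> d + 1"
    using monoD[OF mono_num_partitions] num_partitions_L_le le_trans by blast
next
  assume "num_partitions n \<le> d + 1"
  thus "n \<le> L d" unfolding L_def by (intro Max_ge finite_num_partitions_le) auto
qed

lemma M_eventually_eq_L:
  assumes B: "\<forall>k\<ge>2. M k d \<le> enat B"
  shows "\<exists>N\<ge>1. \<forall>k\<ge>N. M k d = enat (L d)"
proof (intro exI conjI allI impI)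
  \<comment> \<open>Since \<open>k < 2 ^ k\<close>, this threshold gives
    \<open>p(B) + d < 2 ^ k\<close>; the summand 2 ensures \<open>k \<ge> 2\<close>, as
    \<open>B\<close> requires.\<close>
  show "1 \<le> num_partitions B + d + 2" by simp
  fix k assume k: "num_partitions B + d + 2 \<le> k"
  define S where "S = {n. 1 \<le> n \<and> Delta k n \<le> d}"
  have MS: "M k d = (if finite S then enat (Max S) else \<infinity>)" by (simp add: M_def S_def)
  have "M k d \<le> enat B" using B k by simp
  hence fin: "finite S" and "Max S \<le> B" by (auto simp: MS split: if_splits)
  hence le_B: "n \<le> B" if "n \<in> S" for n using that Max_ge le_trans by blast
  have "k < 2 ^ k" by simp
  hence "int (num_partitions B + d) < int (2 ^ k)"
    using k unfolding of_nat_less_iff by linarith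
  hence big: "int (num_partitions B) + int d < 2 ^ k" by simp
  have "num_partitions n \<le> d + 1" if n: "n \<in> S" for n
  proof -
    obtain m :: int where m: "\<bar>int (num_partitions n) - m ^ k\<bar> \<le> int d"
      using n by (auto simp: S_def Delta_le_iff)
    have "num_partitions n \<le> num_partitions B"
      using le_B[OF n] mono_num_partitions by (simp add: monoD)
    with m big have "m ^ k < 2 ^ k" by linarith
    show ?thesis
    proof (cases "\<bar>m\<bar> \<le> 1")
      case True
      hence "\<bar>m ^ k\<bar> \<le> 1" by (simp add: power_abs power_le_one)
      with m show ?thesis by linarith
    next
      case False
      \<comment> \<open>Only a negative power remains, and it lies more than \<open>d\<close> below
        the positive \<open>p(n)\<close>.\<close>
      have "2 ^ k \<le> \<bar>m\<bar> ^ k" using False by (intro power_mono) auto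
      hence "2 ^ k \<le> \<bar>m ^ k\<bar>" by (simp add: power_abs)
      with \<open>m ^ k < 2 ^ k\<close> have "m ^ k \<le> - (2 ^ k)" by linarith
      with m big show ?thesis by linarith
    qed
  qed
  hence "n \<le> L d" if "n \<in> S" for n using that le_L_iff by blast
  moreover have "L d \<in> S"
  proof -
    have "1 \<le> L d" unfolding le_L_iff using num_partitions_1 by simp
    moreover have "Delta k (L d) \<le> d"
      \<comment> \<open>The power \<open>1 ^ k\<close> serves for every \<open>k\<close>, as
        \<open>1 \<le> p(L d) \<le> d + 1\<close>.\<close>
      unfolding Delta_le_iff
      using num_partitions_L_le[of d] monoD[OF mono_num_partitions, of 0 "L d"] num_partitions_0
      by (intro exI[of _ 1]) simp
    ultimately show ?thesis by (simp add: S_def)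
  qed
  ultimately have "Max S = L d" using fin by (intro Max_eqI)
  with fin show "M k d = enat (L d)" by (simp add: MS)
qed

text \<open>Such an \<open>n\<close> exceeds \<open>L d\<close> but belongs to the set whose maximum
  defines \<open>M k d\<close>.\<close>

lemma M_neq_L:
  assumes "num_partitions n > d + 1" "\<bar>int (num_partitions n) - 2 ^ k\<bar> \<le> int d"
  shows "M k d \<noteq> enat (L d)"
proof
  define S where "S = {n. 1 \<le> n \<and> Delta k n \<le> d}"
  assume "M k d = enat (L d)"
  hence "finite S" "Max S = L d" by (auto simp: M_def S_def Let_def split: if_splits)
  moreover have "1 \<le> n" using assms(1) num_partitions_0 by (cases n) auto
  with assms(2) have "n \<in> S" by (auto simp: S_def Delta_le_iff)
  ultimately have "n \<le> L d" using Max_ge by metis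
  with assms(1) show False by (simp add: le_L_iff)
qed

section \<open>Gap estimate and powers of two near partition numbers\<close>

lemma eventually_partitions_without_one_le:
  fixes \<theta> :: real
  assumes "0 < \<theta>" "\<theta> < 1"
  shows "\<forall>\<^sub>F n in sequentially.
    2 * real (card {P \<in> partitions n. 1 \<notin># P}) * ln (num_partitions n) powr \<theta> \<le> num_partitions n"
proof -
  \<comment> \<open>The midpoint of \<open>\<theta> / 2\<close> and \<open>1 / 2\<close>.\<close>
  define \<alpha> where "\<alpha> = (\<theta> + 1) / 4"
  have \<alpha>: "\<theta> < 2 * \<alpha>" "\<alpha> < 1/2" "0 < \<alpha>" using assms by (auto simp: \<alpha>_def)
  \<comment> \<open>With \<open>r\<close> the floor of \<open>n powr \<alpha>\<close>, the three
    estimates yield in turn \<open>4 * ln p powr \<theta> \<le> r\<close>, then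
    \<open>r * (n + 1) ^ (2 * r) \<le> p\<close> via logarithms, and \<open>r > 0\<close>.\<close>
  have "\<forall>\<^sub>F x in at_top. 4 * (2 * sqrt (2 * x) * ln (x + 1)) powr \<theta> \<le> x powr \<alpha> - 1"
    using assms \<alpha> by real_asymp
  moreover have "\<forall>\<^sub>F x in at_top. \<alpha> * ln x + 2 * x powr \<alpha> * ln (x + 1) \<le> (sqrt x - 2) * ln 2"
    using \<alpha> by real_asymp
  moreover have "\<forall>\<^sub>F x in at_top. 2 \<le> x powr \<alpha>"
    using \<alpha> by real_asymp
  ultimately have "\<forall>\<^sub>F x::real in at_top.
      4 * (2 * sqrt (2 * x) * ln (x + 1)) powr \<theta> \<le> x powr \<alpha> - 1 \<and>
      \<alpha> * ln x + 2 * x powr \<alpha> * ln (x + 1) \<le> (sqrt x - 2) * ln 2 \<and> 2 \<le> x powr \<alpha>"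
    by (intro eventually_conj)
  hence "\<forall>\<^sub>F n in sequentially.
      4 * (2 * sqrt (2 * real n) * ln (real n + 1)) powr \<theta> \<le> real n powr \<alpha> - 1 \<and>
      \<alpha> * ln (real n) + 2 * real n powr \<alpha> * ln (real n + 1) \<le> (sqrt (real n) - 2) * ln 2 \<and>
      2 \<le> real n powr \<alpha>"
    by (rule eventually_compose_filterlim[OF _ filterlim_real_sequentially])
  thus ?thesis
    using eventually_gt_at_top[of 0]
  proof eventually_elim
    case (elim n)
    define r where "r = nat \<lfloor>real n powr \<alpha>\<rfloor>"
    define q where "q = card {P \<in> partitions n. 1 \<notin># P}"
    define p where "p = num_partitions n"
    have r: "real r \<le> real n powr \<alpha>" "real n powr \<alpha> - 1 \<le> real r" "0 < r"
      using elim by (auto simp: r_def)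
    have p: "0 < p"
      using monoD[OF mono_num_partitions, of 0 n] num_partitions_0 by (simp add: p_def)
    define m where "m = nat \<lfloor>sqrt n\<rfloor>"
    have m: "real m \<le> sqrt n" "sqrt n - 1 \<le> real m" by (auto simp: m_def)
    have "real m ^ 2 \<le> real n" using power_mono[OF m(1), of 2] by simp
    hence "m ^ 2 \<le> n" by (metis of_nat_le_iff of_nat_power)
    hence "2 ^ (m - 1) \<le> p" unfolding p_def by (rule two_power_le_num_partitions)
    have "real (r * (n + 1) ^ (2 * r)) \<le> 2 ^ (m - 1)"
    proof (subst ln_le_cancel_iff[symmetric])
      have "ln (real (r * (n + 1) ^ (2 * r))) = ln r + 2 * real r * ln (real n + 1)"
        using r(3) by (simp add: ln_mult ln_realpow add.commute)
      also have "ln r \<le> ln (real n powr \<alpha>)" using r elim by (subst ln_le_cancel_iff) auto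
      also have "ln (real n powr \<alpha>) = \<alpha> * ln n" using elim by (simp add: ln_powr)
      also have "2 * real r * ln (real n + 1) \<le> 2 * real n powr \<alpha> * ln (real n + 1)"
        using r by (intro mult_right_mono) auto
      also have "\<alpha> * ln n + \<dots> \<le> (sqrt n - 2) * ln 2" using elim by auto
      \<comment> \<open>Truncation at \<open>m = 0\<close> only helps.\<close>
      also have "\<dots> \<le> real (m - 1) * ln 2" using m by (intro mult_right_mono) auto
      also have "\<dots> = ln (2 ^ (m - 1))" by (simp add: ln_realpow)
      finally show "ln (real (r * (n + 1) ^ (2 * r))) \<le> ln (2 ^ (m - 1))" by simp
    qed (use r in auto)
    also have "\<dots> \<le> real p"
      using \<open>2 ^ (m - 1) \<le> p\<close> by (metis of_nat_le_iff of_nat_numeral of_nat_power)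
    finally have "r * (n + 1) ^ (2 * r) \<le> p" by (simp only: of_nat_le_iff)
    hence "r * q \<le> 2 * p"
      using partitions_without_one_bound[of r n] unfolding p_def q_def by linarith
    hence rq: "real r * real q \<le> 2 * real p" by (metis of_nat_le_iff of_nat_mult of_nat_numeral)
    have "4 * ln p powr \<theta> \<le> 4 * (2 * sqrt (2 * real n) * ln (real n + 1)) powr \<theta>"
      using ln_num_partitions_le[of n] p assms by (auto simp: p_def add.commute intro!: powr_mono2)
    also have "\<dots> \<le> real r" using elim r by linarith
    finally have "4 * ln p powr \<theta> * real q \<le> real r * real q" by (rule mult_right_mono) simp
    with rq show ?case unfolding p_def q_def by (simp add: algebra_simps)
  qed
qed

lemma power_of_two_near_num_partitions:
  fixes A :: real
  assumes "0 < A" "A < 1 / ln 2"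
  shows "\<forall>\<^sub>F d in sequentially.
    \<exists>k n. real_of_int \<lfloor>log 2 d\<rfloor> + A * ln (ln d) \<le> real (k + 1) \<and>
      d + 1 < num_partitions n \<and> \<bar>int (num_partitions n) - 2 ^ k\<bar> \<le> int d"
proof -
  define \<theta> where "\<theta> = A * ln 2"
  have \<theta>: "0 < \<theta>" "\<theta> < 1" using assms by (auto simp: \<theta>_def field_simps)
  obtain n0 where n0: "\<And>n. n \<ge> n0 \<Longrightarrow>
    2 * real (card {P \<in> partitions n. 1 \<notin># P}) * ln (num_partitions n) powr \<theta> \<le> num_partitions n"
    using eventually_partitions_without_one_le[OF \<theta>] by (auto simp: eventually_at_top_linorder)
  \<comment> \<open>The 2 leaves room for an integer \<open>k < t\<close> with
    \<open>k \<ge> l + 1\<close>, so that \<open>2 ^ k > d\<close>.\<close>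
  have "\<forall>\<^sub>F d::nat in sequentially. 2 \<le> A * ln (ln d)" using assms by real_asymp
  moreover have "\<forall>\<^sub>F d::nat in sequentially. 1 \<le> ln d" by real_asymp
  ultimately show ?thesis
    using eventually_ge_at_top[of "num_partitions n0"] eventually_gt_at_top[of 0]
  proof eventually_elim
    case (elim d)
    define l where "l = \<lfloor>log 2 d\<rfloor>"
    define t where "t = real_of_int l + A * ln (ln d)"
    \<comment> \<open>The ceiling, not the floor, gives both \<open>k < t\<close> and
      \<open>t \<le> k + 1\<close>, even for integral \<open>t\<close>.\<close>
    define k where "k = nat \<lceil>t\<rceil> - 1"
    have "0 \<le> l" using elim by (simp add: l_def)
    have l: "real_of_int l \<le> log 2 d" "log 2 d < real_of_int l + 1" by (auto simp: l_def)
    have "real_of_int l + 2 \<le> t" using elim by (simp add: t_def)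
    hence k: "t \<le> real (k + 1)" "real k < t" "real_of_int l + 1 \<le> real k"
      using \<open>0 \<le> l\<close> by (auto simp: k_def) linarith+
    have "real d < 2 powr real k" using l k elim by (simp add: log_less_iff[symmetric])
    hence "real d < real (2 ^ k)" by (simp add: powr_realpow)
    hence d_less: "d < 2 ^ k" by (simp only: of_nat_less_iff)
    have "2 powr real k \<le> 2 powr (log 2 d + A * ln (ln d))"
      using k l by (intro powr_mono) (auto simp: t_def)
    moreover
    have "2 powr (A * ln (ln d)) = ln d powr \<theta>"
      using elim by (auto simp: \<theta>_def powr_def mult_ac)
    hence "2 powr (log 2 d + A * ln (ln d)) = real d * ln d powr \<theta>"
      using elim by (simp add: powr_add)
    ultimately have k_le: "2 ^ k \<le> real d * ln d powr \<theta>" by (simp add: powr_realpow)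
    define n where "n = (LEAST n. 2 ^ k < num_partitions n)"
    have "2 ^ k < num_partitions (Suc (2 ^ k))" using num_partitions_ge[of "Suc (2 ^ k)"] by simp
    hence n: "2 ^ k < num_partitions n" unfolding n_def by (rule LeastI)
    then obtain j where j: "n = Suc j" using num_partitions_0 by (cases n) auto
    have "\<not> 2 ^ k < num_partitions j" 
      using not_less_Least[of j "\<lambda>n. 2 ^ k < num_partitions n"] j unfolding n_def by simp
    define q where "q = card {P \<in> partitions n. 1 \<notin># P}"
    define p where "p = num_partitions n"
    \<comment> \<open>By minimality \<open>p(n - 1) \<le> 2 ^ k\<close>, so the overshoot is at most
      the gap \<open>q\<close>.\<close>
    have p_le: "p \<le> 2 ^ k + q"
      using \<open>\<not> 2 ^ k < num_partitions j\<close> num_partitions_Suc[of j] j by (simp add: p_def q_def)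
    have "d + 1 < p" using n d_less by (simp add: p_def)
    have "n \<ge> n0"
    proof (rule ccontr)
      assume "\<not> n \<ge> n0"
      hence "p \<le> num_partitions n0" unfolding p_def by (intro monoD[OF mono_num_partitions]) simp
      with \<open>d + 1 < p\<close> elim show False by simp
    qed
    define s where "s = ln d powr \<theta>"
    have "s \<ge> 1" using elim \<theta> by (simp add: s_def ge_one_powr_ge_zero)
    have "2 * real q * s \<le> 2 * real q * ln p powr \<theta>"
      unfolding s_def using \<open>d + 1 < p\<close> elim \<theta> by (intro mult_left_mono powr_mono2) auto
    also have "\<dots> \<le> real p" using n0[OF \<open>n \<ge> n0\<close>] by (simp add: p_def q_def)
    finally have qs: "2 * (real q * s) \<le> real p" by simp
    \<comment> \<open>The factor 2 absorbs the overshoot: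
      \<open>2 * q * s \<le> p \<le> 2 ^ k + q * s\<close>, hence
      \<open>q * s \<le> 2 ^ k \<le> d * s\<close>.\<close>
    have "real q \<le> real q * s" using \<open>s \<ge> 1\<close> by (simp add: mult_le_cancel_left1)
    have "real p \<le> 2 ^ k + real q"
      using p_le by (metis of_nat_add of_nat_le_iff of_nat_numeral of_nat_power)
    hence "real q * s \<le> 2 ^ k" using qs \<open>real q \<le> real q * s\<close> by linarith
    also have "\<dots> \<le> real d * s" using k_le by (simp add: s_def)
    finally have "real q \<le> real d" using \<open>s \<ge> 1\<close> by simp
    hence "q \<le> d" by simp
    have "int (2 ^ k) < int p" "int p \<le> int (2 ^ k + q)"
      using n p_le unfolding p_def of_nat_less_iff of_nat_le_iff .
    with \<open>q \<le> d\<close> have "\<bar>int p - 2 ^ k\<bar> \<le> int d" by simp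
    with k(1) \<open>d + 1 < p\<close> show ?case unfolding t_def l_def p_def by blast
  qed
qed

theorem theorem1p2:
  assumes bounded: "\<And>d::nat. \<exists>B::nat. \<forall>k\<ge>2. M k d \<le> enat B"
  shows "\<exists>N :: nat \<Rightarrow> nat.
    (\<forall>d. 1 \<le> N d \<and> (\<forall>k\<ge>N d. M k d = enat (L d)) \<and>
         (\<forall>N'\<ge>1. (\<forall>k\<ge>N'. M k d = enat (L d)) \<longrightarrow> N d \<le> N')) \<and>
    (\<forall>A::real. 0 < A \<and> A < 1 / ln 2 \<longrightarrow>
      (\<forall>\<^sub>F d in sequentially.
        real (N d) \<ge> real_of_int \<lfloor>log 2 (real d)\<rfloor> + A * ln (ln (real d))))"
proof -
  define Q where "Q = (\<lambda>d N. 1 \<le> N \<and> (\<forall>k\<ge>N. M k d = enat (L d)))"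
  define N where "N = (\<lambda>d. LEAST N. Q d N)"
  have "\<exists>N. Q d N" for d using bounded[of d] M_eventually_eq_L unfolding Q_def by blast
  hence QN: "Q d (N d)" for d unfolding N_def by (metis LeastI)
  have least: "N d \<le> N'" if "Q d N'" for d N' unfolding N_def using that by (rule Least_le)
  have "\<forall>\<^sub>F d in sequentially. real (N d) \<ge> real_of_int \<lfloor>log 2 (real d)\<rfloor> + A * ln (ln (real d))"
    if "0 < A" "A < 1 / ln 2" for A :: real
    using power_of_two_near_num_partitions[OF that]
  proof eventually_elim
    case (elim d)
    then obtain k n where k: "real_of_int \<lfloor>log 2 d\<rfloor> + A * ln (ln d) \<le> real (k + 1)"
      and "d + 1 < num_partitions n" "\<bar>int (num_partitions n) - 2 ^ k\<bar> \<le> int d" by blast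
    \<comment> \<open>A failure at \<open>k\<close> forces \<open>N d \<ge> k + 1\<close>, which is
      why the bound was stated with \<open>k + 1\<close>.\<close>
    hence "M k d \<noteq> enat (L d)" by (intro M_neq_L)
    hence "k < N d" using QN[of d] unfolding Q_def by (meson not_le)
    with k show ?case by linarith
  qed
  thus ?thesis using QN least unfolding Q_def by (intro exI[of _ N]) blast
qed

end
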